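(* Let $n\ge 2$ and let $R=\mathbb{Z}[t_1^{\pm1},\ldots,t_n^{\pm1}]$. The representation $\hat{\rho}_G: Cb_n\to GL_n(R)$ is reducible.
   Context: Let $\mathbb{F}_n$ be the free group on $x_1,\ldots,x_n$. The group $Cb_n$ of basis conjugating automorphisms is the subgroup of $\mathrm{Aut}(\mathbb{F}_n)$ of all automorphisms $\phi$ such that for each $i$, $\phi(x_i)=f_i^{-1}x_if_i$ for some $f_i\in\mathbb{F}_n$. It is generated (McCool) by the automorphisms $\epsilon_{ij}$, $1\le i\ne j\le n$, where $\epsilon_{ij}(x_i)=x_j^{-1}x_ix_j$ and $\epsilon_{ij}(x_l)=x_l$ for $l\ne i$. Products of automorphisms are taken in the right-action convention: $\phi\psi$ means first apply $\phi$, then $\psi$. Let $t_1,\ldots,t_n$ be indeterminates. The representation $\hat{\rho}_G:Cb_n\to GL_n(R)$ (Bardakov's extension of the Gassner representation) is the homomorphism such that, for $i\ne j$, $\hat{\rho}_G(\epsilon_{ij})$ is the matrix that agrees with the identity matrix except in row $i$, where the $(i,i)$ entry is $t_j^{-1}$, the $(i,j)$ entry is $t_j^{-1}(t_i-1)$, and all other entries are $0$. (These assignments do define a homomorphism.) The matrices act on column vectors from the left. Reducible means: after extending scalars to the fraction field $K=\mathbb{Q}(t_1,\ldots,t_n)$ of $R$, there is a $K$-subspace of $K^n$ (column vectors), different from $0$ and $K^n$, that is invariant under $\hat{\rho}_G(g)$ for all $g\in Cb_n$. *)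

theory Defs
  imports
    "HOL-Analysis.Analysis"
    "HOL-Algebra.Bij"
    "HOL-Computational_Algebra.Polynomial_Factorial"
    "HOL-Library.Poly_Mapping"
begin

text \<open>
  The index set \<open>{1..n}\<close> is a finite linearly ordered type \<open>'n\<close> with \<open>CARD('n) = n\<close>.
  The order is only used to see that Laurent polynomials form an integral domain.
\<close>

section \<open>The free group\<close>

text \<open>Reduced words; the letter \<open>(i, True)\<close> stands for \<open>x\<^sub>i\<close> and \<open>(i, False)\<close> for its inverse.\<close>

type_synonym 'n fword = "('n \<times> bool) list"

definition inv_letter :: "'n \<times> bool \<Rightarrow> 'n \<times> bool" where
  "inv_letter a = (fst a, \<not> snd a)"

definition reduced :: "'n fword \<Rightarrow> bool" where
  "reduced w \<longleftrightarrow> successively (\<lambda>a b. b \<noteq> inv_letter a) w"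

fun push :: "'n \<times> bool \<Rightarrow> 'n fword \<Rightarrow> 'n fword" where
  "push a [] = [a]"
| "push a (b # w) = (if b = inv_letter a then w else a # b # w)"

definition free_group :: "'n fword monoid" where
  "free_group = \<lparr>carrier = {w. reduced w}, mult = (\<lambda>u v. foldr push u v), one = []\<rparr>"

definition gen :: "'n \<Rightarrow> 'n fword" where
  "gen i = [(i, True)]"

definition free_lift :: "('a, 'b) monoid_scheme \<Rightarrow> ('n \<Rightarrow> 'a) \<Rightarrow> 'n fword \<Rightarrow> 'a" where
  "free_lift G f w = foldr (\<lambda>a y. (if snd a then f (fst a) else inv\<^bsub>G\<^esub> f (fst a)) \<otimes>\<^bsub>G\<^esub> y) w \<one>\<^bsub>G\<^esub>"

lemma inv_letter_inv_letter [simp]: "inv_letter (inv_letter a) = a"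
  by (simp add: inv_letter_def)

lemma inv_letter_neq [simp]: "inv_letter a \<noteq> a" "a \<noteq> inv_letter a"
  by (auto simp: inv_letter_def prod_eq_iff)

lemma inv_letter_eq_iff: "inv_letter a = b \<longleftrightarrow> a = inv_letter b"
  by (auto simp: inv_letter_def prod_eq_iff)

lemma reduced_Nil [simp]: "reduced []"
  by (simp add: reduced_def)

lemma reduced_single [simp]: "reduced [a]"
  by (simp add: reduced_def)

lemma reduced_Cons_Cons [simp]: "reduced (a # b # w) \<longleftrightarrow> b \<noteq> inv_letter a \<and> reduced (b # w)"
  by (simp add: reduced_def)

lemma reduced_ConsD: "reduced (a # w) \<Longrightarrow> reduced w"
  by (cases w) auto

lemma reduced_push: "reduced w \<Longrightarrow> reduced (push a w)"
  by (cases w) (auto dest: reduced_ConsD)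

lemma reduced_foldr_push: "reduced v \<Longrightarrow> reduced (foldr push u v)"
  by (induction u) (auto intro: reduced_push)

lemma push_Cons_reduced: "reduced (a # w) \<Longrightarrow> push a w = a # w"
  by (cases w) auto

lemma push_push_inv:
  assumes "reduced w" shows "push a (push (inv_letter a) w) = w"
proof (cases w)
  case (Cons b v)
  then show ?thesis using assms by (auto simp: push_Cons_reduced)
qed auto

lemma foldr_push_push:
  assumes "reduced w" shows "foldr push (push a v) w = push a (foldr push v w)"
proof (cases v)
  case (Cons b u)
  then show ?thesis
    using push_push_inv[OF reduced_foldr_push[OF assms, of u], of a] by auto
qed auto

lemma foldr_push_assoc:
  "reduced w \<Longrightarrow> foldr push (foldr push u v) w = foldr push u (foldr push v w)"
  by (induction u) (auto simp: foldr_push_push)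

lemma foldr_push_Nil: "reduced w \<Longrightarrow> foldr push w [] = w"
proof (induction w)
  case (Cons a w)
  then show ?case using push_Cons_reduced[of a w] reduced_ConsD[of a w] by simp
qed simp

lemma reduced_inv_word: "reduced w \<Longrightarrow> reduced (rev (map inv_letter w))"
  unfolding reduced_def successively_rev successively_map
  by (erule successively_mono) (auto simp: inv_letter_eq_iff)

lemma foldr_push_inv_word: "foldr push (rev (map inv_letter w)) w = []"
  by (induction w) auto

lemma group_free_group: "group free_group"
proof (rule groupI)
  fix w :: "'a fword" assume "w \<in> carrier free_group"
  then show "\<exists>v\<in>carrier free_group. v \<otimes>\<^bsub>free_group\<^esub> w = \<one>\<^bsub>free_group\<^esub>"
    by (intro bexI[of _ "rev (map inv_letter w)"])
      (auto simp: free_group_def reduced_inv_word foldr_push_inv_word)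
qed (auto simp: free_group_def reduced_foldr_push foldr_push_assoc)

lemma gen_in [simp]: "gen i \<in> carrier free_group"
  by (simp add: gen_def free_group_def)

lemma free_lift_hom:
  assumes "group G" and f: "\<And>i. f i \<in> carrier G"
  shows "free_lift G f \<in> hom free_group G"
proof -
  interpret group G by fact
  define val where "val = (\<lambda>a. if snd a then f (fst a) else inv\<^bsub>G\<^esub> f (fst a))"
  have val [simp]: "val a \<in> carrier G" for a
    using f by (auto simp: val_def)
  have vi: "val a \<otimes>\<^bsub>G\<^esub> val (inv_letter a) = \<one>\<^bsub>G\<^esub>" for a
    using f by (auto simp: val_def inv_letter_def)
  have Nil [simp]: "free_lift G f [] = \<one>\<^bsub>G\<^esub>"
    and Cons [simp]: "free_lift G f (a # w) = val a \<otimes>\<^bsub>G\<^esub> free_lift G f w" for a w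
    by (auto simp: free_lift_def val_def)
  have cl [simp]: "free_lift G f w \<in> carrier G" for w
    by (induction w) auto
  have push: "free_lift G f (push a w) = val a \<otimes>\<^bsub>G\<^esub> free_lift G f w" for a w
  proof (cases w)
    case (Cons b v)
    then show ?thesis
      by (auto simp: vi m_assoc[symmetric])
  qed auto
  have "free_lift G f (foldr push u v) = free_lift G f u \<otimes>\<^bsub>G\<^esub> free_lift G f v" for u v
    by (induction u) (auto simp: push m_assoc)
  then show ?thesis
    by (auto simp: hom_def free_group_def)
qed

lemma free_lift_gen:
  assumes "group G" "f i \<in> carrier G" shows "free_lift G f (gen i) = f i"
proof -
  interpret group G by fact
  show ?thesis using assms(2) by (simp add: free_lift_def gen_def)
qed

lemma free_group_hom_eqI:
  assumes "group G" and h: "h \<in> hom free_group G" and k: "k \<in> hom free_group G"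
    and eq: "\<And>i. h (gen i) = k (gen i)" and w: "w \<in> carrier free_group"
  shows "h w = k w"
proof -
  interpret h: group_hom free_group G h
    using assms group_free_group by (auto simp: group_hom_def group_hom_axioms_def)
  interpret k: group_hom free_group G k
    using assms group_free_group by (auto simp: group_hom_def group_hom_axioms_def)
  have letter: "h [a] = k [a]" for a
  proof (cases "snd a")
    case True
    then show ?thesis using eq[of "fst a"] by (cases a) (auto simp: gen_def)
  next
    case False
    then have "[a] \<otimes>\<^bsub>free_group\<^esub> gen (fst a) = \<one>\<^bsub>free_group\<^esub>" "[a] \<in> carrier free_group"
      by (auto simp: free_group_def gen_def inv_letter_def prod_eq_iff)
    then have "[a] = inv\<^bsub>free_group\<^esub> gen (fst a)"
      using h.G.inv_equality[of "[a]" "gen (fst a)"] by auto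
    then show ?thesis using eq[of "fst a"] by simp
  qed
  from w show ?thesis
  proof (induction w)
    case Nil
    then show ?case using h.hom_one k.hom_one by (simp add: free_group_def)
  next
    case (Cons a w)
    have "a # w = [a] \<otimes>\<^bsub>free_group\<^esub> w" "[a] \<in> carrier free_group" "w \<in> carrier free_group"
      using Cons.prems by (auto simp: free_group_def push_Cons_reduced dest: reduced_ConsD)
    then show ?case using Cons.IH letter by (metis h.hom_mult k.hom_mult)
  qed
qed


section \<open>Basis conjugating automorphisms\<close>

definition basis_conj_auts :: "('n fword \<Rightarrow> 'n fword) set" where
  "basis_conj_auts = {\<phi> \<in> auto free_group. \<forall>i. \<exists>f \<in> carrier free_group.
     \<phi> (gen i) = inv\<^bsub>free_group\<^esub> f \<otimes>\<^bsub>free_group\<^esub> gen i \<otimes>\<^bsub>free_group\<^esub> f}"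

text \<open>
  \<^const>\<open>AutoGroup\<close> multiplies by ordinary composition; here automorphisms act from the right,
  so the product of \<open>\<phi>\<close> and \<open>\<psi>\<close> is first \<open>\<phi>\<close>, then \<open>\<psi>\<close>.
\<close>

definition Cb :: "('n fword \<Rightarrow> 'n fword) monoid" where
  "Cb = \<lparr>carrier = basis_conj_auts,
         mult = (\<lambda>\<phi> \<psi>. \<psi> \<otimes>\<^bsub>AutoGroup free_group\<^esub> \<phi>),
         one = \<one>\<^bsub>AutoGroup free_group\<^esub>\<rparr>"

definition eps :: "'n \<Rightarrow> 'n \<Rightarrow> 'n fword \<Rightarrow> 'n fword" where
  "eps i j = restrict (free_lift free_group (\<lambda>l. if l = i
      then inv\<^bsub>free_group\<^esub> gen j \<otimes>\<^bsub>free_group\<^esub> gen i \<otimes>\<^bsub>free_group\<^esub> gen j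
      else gen l)) (carrier free_group)"



lemma subgroup_basis_conj_auts: "subgroup basis_conj_auts (AutoGroup free_group)"
proof -
  interpret F: group "free_group :: 'a fword monoid" by (rule group_free_group)
  interpret A: group "AutoGroup (free_group :: 'a fword monoid)" by (rule F.AutoGroup)
  have carr: "carrier (AutoGroup free_group) = auto (free_group :: 'a fword monoid)"
    by (simp add: AutoGroup_def)
  have hom: "\<phi> \<in> hom free_group free_group" if "\<phi> \<in> auto free_group"
    for \<phi> :: "'a fword \<Rightarrow> 'a fword" using that by (simp add: auto_def)
  have ghom: "group_hom free_group free_group \<phi>" if "\<phi> \<in> auto free_group"
    for \<phi> :: "'a fword \<Rightarrow> 'a fword"
    using hom[OF that] by (simp add: group_hom_def group_hom_axioms_def F.group_axioms)
  have app: "(\<phi> \<otimes>\<^bsub>AutoGroup free_group\<^esub> \<psi>) w = \<phi> (\<psi> w)"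
    if "\<phi> \<in> auto free_group" "\<psi> \<in> auto free_group" "w \<in> carrier free_group"
    for \<phi> \<psi> :: "'a fword \<Rightarrow> 'a fword" and w
    using that by (simp add: AutoGroup_def BijGroup_def auto_def compose_eq)
  show ?thesis
  proof (rule A.subgroupI)
    show "basis_conj_auts \<subseteq> carrier (AutoGroup (free_group :: 'a fword monoid))"
      by (auto simp: carr basis_conj_auts_def)
    have "(\<lambda>x\<in>carrier free_group. x) \<in> (basis_conj_auts :: ('a fword \<Rightarrow> _) set)"
      by (auto simp: basis_conj_auts_def F.id_in_auto intro!: bexI[of _ "\<one>\<^bsub>free_group\<^esub>"])
    then show "(basis_conj_auts :: ('a fword \<Rightarrow> 'a fword) set) \<noteq> {}" by blast
  next
    fix \<phi> :: "'a fword \<Rightarrow> 'a fword" assume \<phi>: "\<phi> \<in> basis_conj_auts"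
    then have \<phi>a: "\<phi> \<in> auto free_group" by (simp add: basis_conj_auts_def)
    interpret p: group_hom free_group free_group \<phi> using ghom[OF \<phi>a] .
    define \<psi> where "\<psi> = inv\<^bsub>AutoGroup free_group\<^esub> \<phi>"
    have \<psi>a: "\<psi> \<in> auto free_group" using A.inv_closed[of \<phi>] \<phi>a by (simp add: carr \<psi>_def)
    interpret q: group_hom free_group free_group \<psi> using ghom[OF \<psi>a] .
    have qp: "\<psi> (\<phi> w) = w" if "w \<in> carrier free_group" for w
    proof -
      have "(\<psi> \<otimes>\<^bsub>AutoGroup free_group\<^esub> \<phi>) w = w"
        using A.l_inv[of \<phi>] \<phi>a that by (simp add: carr \<psi>_def) (simp add: AutoGroup_def BijGroup_def)
      then show ?thesis using app[OF \<psi>a \<phi>a that] by simp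
    qed
    have "\<exists>f\<in>carrier free_group. \<psi> (gen i) =
        inv\<^bsub>free_group\<^esub> f \<otimes>\<^bsub>free_group\<^esub> gen i \<otimes>\<^bsub>free_group\<^esub> f" for i
    proof -
      obtain f where f: "f \<in> carrier free_group"
        and eq: "\<phi> (gen i) = inv\<^bsub>free_group\<^esub> f \<otimes>\<^bsub>free_group\<^esub> gen i \<otimes>\<^bsub>free_group\<^esub> f"
        using \<phi> by (auto simp: basis_conj_auts_def)
      have "gen i = \<psi> (\<phi> (gen i))" by (simp add: qp)
      also have "\<dots> = inv\<^bsub>free_group\<^esub> \<psi> f \<otimes>\<^bsub>free_group\<^esub> \<psi> (gen i) \<otimes>\<^bsub>free_group\<^esub> \<psi> f"
        using f by (simp add: eq)
      finally have "\<psi> f \<otimes>\<^bsub>free_group\<^esub> gen i \<otimes>\<^bsub>free_group\<^esub> inv\<^bsub>free_group\<^esub> \<psi> f = \<psi> (gen i)"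
        using f by (metis F.inv_closed F.inv_solve_left F.inv_solve_right' F.m_closed F.m_assoc gen_in q.hom_closed)
      then show ?thesis using f
        by (intro bexI[of _ "inv\<^bsub>free_group\<^esub> \<psi> f"]) auto
    qed
    then show "inv\<^bsub>AutoGroup free_group\<^esub> \<phi> \<in> basis_conj_auts"
      using \<psi>a by (simp add: basis_conj_auts_def \<psi>_def)
  next
    fix \<phi> \<psi> :: "'a fword \<Rightarrow> 'a fword"
    assume *: "\<phi> \<in> basis_conj_auts" "\<psi> \<in> basis_conj_auts"
    then have a: "\<phi> \<in> auto free_group" "\<psi> \<in> auto free_group" by (auto simp: basis_conj_auts_def)
    interpret p: group_hom free_group free_group \<phi> using ghom[OF a(1)] .
    have "\<exists>h\<in>carrier free_group. \<phi> (\<psi> (gen i)) =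
        inv\<^bsub>free_group\<^esub> h \<otimes>\<^bsub>free_group\<^esub> gen i \<otimes>\<^bsub>free_group\<^esub> h" for i
    proof -
      obtain f g where f: "f \<in> carrier free_group" "g \<in> carrier free_group"
        and eq: "\<phi> (gen i) = inv\<^bsub>free_group\<^esub> f \<otimes>\<^bsub>free_group\<^esub> gen i \<otimes>\<^bsub>free_group\<^esub> f"
          "\<psi> (gen i) = inv\<^bsub>free_group\<^esub> g \<otimes>\<^bsub>free_group\<^esub> gen i \<otimes>\<^bsub>free_group\<^esub> g"
        using * unfolding basis_conj_auts_def by blast
      then show ?thesis
        by (intro bexI[of _ "f \<otimes>\<^bsub>free_group\<^esub> \<phi> g"]) (auto simp: F.inv_mult_group F.m_assoc)
    qed
    moreover have "\<phi> \<otimes>\<^bsub>AutoGroup free_group\<^esub> \<psi> \<in> auto free_group"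
      using A.m_closed[of \<phi> \<psi>] a by (simp add: carr)
    ultimately show "\<phi> \<otimes>\<^bsub>AutoGroup free_group\<^esub> \<psi> \<in> basis_conj_auts"
      using app[OF a] by (simp add: basis_conj_auts_def)
  qed
qed

lemma group_Cb: "group Cb"
proof -
  interpret F: group "free_group :: 'a fword monoid" by (rule group_free_group)
  interpret A: group "AutoGroup (free_group :: 'a fword monoid)" by (rule F.AutoGroup)
  interpret S: subgroup basis_conj_auts "AutoGroup (free_group :: 'a fword monoid)"
    by (rule subgroup_basis_conj_auts)
  show "group (Cb :: ('a fword \<Rightarrow> 'a fword) monoid)"
  proof (rule groupI)
    fix \<phi> :: "'a fword \<Rightarrow> 'a fword" assume "\<phi> \<in> carrier Cb"
    then show "\<exists>\<psi>\<in>carrier Cb. \<psi> \<otimes>\<^bsub>Cb\<^esub> \<phi> = \<one>\<^bsub>Cb\<^esub>"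
      by (intro bexI[of _ "inv\<^bsub>AutoGroup free_group\<^esub> \<phi>"]) (auto simp: Cb_def A.r_inv)
  qed (auto simp: Cb_def A.m_assoc)
qed
lemma eps_gen:
  assumes "i \<noteq> j"
  shows "eps i j (gen i) = inv\<^bsub>free_group\<^esub> gen j \<otimes>\<^bsub>free_group\<^esub> gen i \<otimes>\<^bsub>free_group\<^esub> gen j"
    and "l \<noteq> i \<Longrightarrow> eps i j (gen l) = gen l"
proof -
  interpret F: group "free_group :: 'a fword monoid" by (rule group_free_group)
  show "eps i j (gen i) = inv\<^bsub>free_group\<^esub> gen j \<otimes>\<^bsub>free_group\<^esub> gen i \<otimes>\<^bsub>free_group\<^esub> gen j"
    "l \<noteq> i \<Longrightarrow> eps i j (gen l) = gen l"
    by (auto simp: eps_def free_lift_gen[OF group_free_group])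
qed

lemma eps_in_Cb:
  assumes ij: "i \<noteq> j" shows "eps i j \<in> carrier Cb"
proof -
  interpret F: group "free_group :: 'a fword monoid" by (rule group_free_group)
  define h where "h = free_lift free_group (\<lambda>l. if l = i
      then inv\<^bsub>free_group\<^esub> gen j \<otimes>\<^bsub>free_group\<^esub> gen i \<otimes>\<^bsub>free_group\<^esub> gen j else gen l)"
  define k where "k = free_lift free_group (\<lambda>l. if l = i
      then gen j \<otimes>\<^bsub>free_group\<^esub> gen i \<otimes>\<^bsub>free_group\<^esub> inv\<^bsub>free_group\<^esub> gen j else gen l)"
  have h: "h \<in> hom free_group free_group" and k: "k \<in> hom free_group free_group"
    unfolding h_def k_def by (intro free_lift_hom group_free_group; simp)+
  interpret h: group_hom free_group free_group h
    using h by (simp add: group_hom_def group_hom_axioms_def F.group_axioms)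
  interpret k: group_hom free_group free_group k
    using k by (simp add: group_hom_def group_hom_axioms_def F.group_axioms)
  have hg: "h (gen l) = (if l = i
      then inv\<^bsub>free_group\<^esub> gen j \<otimes>\<^bsub>free_group\<^esub> gen i \<otimes>\<^bsub>free_group\<^esub> gen j else gen l)"
    and kg: "k (gen l) = (if l = i
      then gen j \<otimes>\<^bsub>free_group\<^esub> gen i \<otimes>\<^bsub>free_group\<^esub> inv\<^bsub>free_group\<^esub> gen j else gen l)" for l
    unfolding h_def k_def by (auto simp: free_lift_gen[OF group_free_group])
  have cancel: "inv\<^bsub>free_group\<^esub> a \<otimes>\<^bsub>free_group\<^esub> (a \<otimes>\<^bsub>free_group\<^esub> b) = b"
    "a \<otimes>\<^bsub>free_group\<^esub> (inv\<^bsub>free_group\<^esub> a \<otimes>\<^bsub>free_group\<^esub> b) = b"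
    if "a \<in> carrier free_group" "b \<in> carrier free_group" for a b :: "'a fword"
    using that by (simp_all flip: F.m_assoc)
  have kh: "k (h w) = w" if "w \<in> carrier free_group" for w
    using that hg kg ij
    by (intro free_group_hom_eqI[OF group_free_group _ _ _ that, of "\<lambda>w. k (h w)" "\<lambda>w. w"])
      (auto simp: hom_def F.m_assoc cancel)
  have hk: "h (k w) = w" if "w \<in> carrier free_group" for w
    using that hg kg ij
    by (intro free_group_hom_eqI[OF group_free_group _ _ _ that, of "\<lambda>w. h (k w)" "\<lambda>w. w"])
      (auto simp: hom_def F.m_assoc cancel)
  have eq: "eps i j = restrict h (carrier free_group)"
    by (simp add: eps_def h_def)
  have "bij_betw (eps i j) (carrier free_group) (carrier free_group)"
    unfolding eq by (rule bij_betw_byWitness[where f' = k]) (auto simp: kh hk)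
  then have "eps i j \<in> auto free_group"
    using h by (auto simp: auto_def Bij_def eq hom_def)
  moreover have "\<exists>f\<in>carrier free_group. eps i j (gen l) =
      inv\<^bsub>free_group\<^esub> f \<otimes>\<^bsub>free_group\<^esub> gen l \<otimes>\<^bsub>free_group\<^esub> f" for l
    using eps_gen[OF ij]
    by (cases "l = i") (auto intro: bexI[of _ "gen j"] bexI[of _ "\<one>\<^bsub>free_group\<^esub>"])
  ultimately show ?thesis by (simp add: Cb_def basis_conj_auts_def)
qed


section \<open>The extended Gassner representation\<close>

text \<open>
  Integral Laurent polynomials: finitely supported maps from integer exponent vectors to
  integers, with convolution as product. The fraction field of this ring is \<open>\<rat>(t\<^sub>1, \<dots>, t\<^sub>n)\<close>.
\<close>

type_synonym 'n laurent = "('n \<Rightarrow>\<^sub>0 int) \<Rightarrow>\<^sub>0 int"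

definition tvar :: "'n \<Rightarrow> 'n laurent" where
  "tvar i = Poly_Mapping.single (Poly_Mapping.single i 1) 1"

definition tvar_inv :: "'n \<Rightarrow> 'n laurent" where
  "tvar_inv i = Poly_Mapping.single (Poly_Mapping.single i (-1)) 1"

definition GL :: "('a::comm_ring_1 ^ 'n ^ 'n) monoid" where
  "GL = \<lparr>carrier = {A. invertible A}, mult = (**), one = mat 1\<rparr>"

definition gassner_mat :: "'n::finite \<Rightarrow> 'n \<Rightarrow> 'n laurent ^ 'n ^ 'n" where
  "gassner_mat i j = (\<chi> k l.
     if k = i then (if l = i then tvar_inv j else if l = j then tvar_inv j * (tvar i - 1) else 0)
     else mat 1 $ k $ l)"

definition is_ext_gassner_rep ::
    "(('n::finite fword \<Rightarrow> 'n fword) \<Rightarrow> 'n laurent ^ 'n ^ 'n) \<Rightarrow> bool" where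
  "is_ext_gassner_rep \<rho> \<longleftrightarrow> \<rho> \<in> hom Cb GL \<and> (\<forall>i j. i \<noteq> j \<longrightarrow> \<rho> (eps i j) = gassner_mat i j)"

definition reducible_rep ::
    "('g, 'b) monoid_scheme \<Rightarrow> ('g \<Rightarrow> 'a::idom ^ 'n ^ 'n) \<Rightarrow> bool" where
  "reducible_rep G \<rho> \<longleftrightarrow> (\<exists>W :: ('a fract ^ 'n) set.
     vec.subspace W \<and> W \<noteq> {0} \<and> W \<noteq> UNIV \<and>
     (\<forall>g \<in> carrier G. \<forall>v \<in> W. map_matrix to_fract (\<rho> g) *v v \<in> W))"

text \<open>
  The assignment on generators does extend to a homomorphism: take the Jacobian matrix of
  abelianised Fox derivatives.
\<close>

definition ab_letter :: "'n \<times> bool \<Rightarrow> 'n laurent" where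
  "ab_letter a = (if snd a then tvar (fst a) else tvar_inv (fst a))"

definition ab :: "'n fword \<Rightarrow> 'n laurent" where
  "ab w = prod_list (map ab_letter w)"

fun fox :: "'n::finite fword \<Rightarrow> 'n laurent ^ 'n" where
  "fox [] = 0"
| "fox (a # w) = (if snd a then axis (fst a) 1 else axis (fst a) (- tvar_inv (fst a)))
      + ab_letter a *s fox w"

definition fox_jacobian :: "('n::finite fword \<Rightarrow> 'n fword) \<Rightarrow> 'n laurent ^ 'n ^ 'n" where
  "fox_jacobian \<phi> = (\<chi> i. fox (\<phi> (gen i)))"

lemma tvar_tvar_inv [simp]: "tvar i * tvar_inv i = 1" "tvar_inv i * tvar i = 1"
  by (simp_all add: tvar_def tvar_inv_def mult_single flip: single_add)

lemma tvar_tvar_inv_left [simp]: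
  "tvar i * (tvar_inv i * x) = x" "tvar_inv i * (tvar i * x) = x"
  by (simp_all flip: mult.assoc)

lemma ab_mult: "ab (foldr push u v) = ab u * ab v"
proof -
  have "ab (push a w) = ab_letter a * ab w" for a and w :: "'a fword"
    by (cases w) (auto simp: ab_def ab_letter_def inv_letter_def)
  then show ?thesis
    by (induction u) (auto simp: ab_def mult.assoc)
qed

lemma fox_mult:
  fixes u v :: "'n::finite fword"
  shows "fox (foldr push u v) = fox u + ab u *s fox v"
proof -
  have "fox (push a w) = fox [a] + ab_letter a *s fox w" for a and w :: "'n fword"
    by (cases w) (auto simp: ab_letter_def inv_letter_def axis_def vec_eq_iff algebra_simps)
  then show ?thesis
    by (induction u) (auto simp: ab_def vec_eq_iff algebra_simps)
qed

lemma fox_inv_mult: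
  fixes w v :: "'n::finite fword"
  assumes w: "w \<in> carrier free_group"
  shows "ab (inv\<^bsub>free_group\<^esub> w) * ab w = 1"
    and "fox (inv\<^bsub>free_group\<^esub> w) = - (ab (inv\<^bsub>free_group\<^esub> w) *s fox w)"
proof -
  interpret F: group "free_group :: 'n fword monoid" by (rule group_free_group)
  have "foldr push (inv\<^bsub>free_group\<^esub> w) w = []"
    using F.l_inv[OF w] by (simp add: free_group_def)
  then show "ab (inv\<^bsub>free_group\<^esub> w) * ab w = 1"
    and "fox (inv\<^bsub>free_group\<^esub> w) = - (ab (inv\<^bsub>free_group\<^esub> w) *s fox w)"
    using ab_mult[of "inv\<^bsub>free_group\<^esub> w" w] fox_mult[of "inv\<^bsub>free_group\<^esub> w" w]
    by (auto simp: ab_def eq_neg_iff_add_eq_0)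
qed

lemma inv_gen: "inv\<^bsub>free_group\<^esub> gen i = [(i, False)]"
proof -
  interpret F: group "free_group :: 'a fword monoid" by (rule group_free_group)
  show ?thesis
    by (rule F.inv_equality) (auto simp: free_group_def gen_def inv_letter_def)
qed

lemma basis_conj_fox:
  fixes \<phi> :: "'n::finite fword \<Rightarrow> 'n fword"
  assumes \<phi>: "\<phi> \<in> basis_conj_auts" and w: "w \<in> carrier free_group"
  shows "ab (\<phi> w) = ab w \<and> fox (\<phi> w) = fox w v* fox_jacobian \<phi>"
proof -
  interpret F: group "free_group :: 'n fword monoid" by (rule group_free_group)
  interpret p: group_hom free_group free_group \<phi>
    using \<phi> by (simp add: basis_conj_auts_def auto_def group_hom_def group_hom_axioms_def F.group_axioms)
  have mult: "u \<otimes>\<^bsub>free_group\<^esub> v = foldr push u v" for u v :: "'n fword"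
    by (simp add: free_group_def)
  have abg: "ab (\<phi> (gen i)) = ab (gen i)" for i
  proof -
    obtain f where f: "f \<in> carrier free_group"
      and "\<phi> (gen i) = inv\<^bsub>free_group\<^esub> f \<otimes>\<^bsub>free_group\<^esub> gen i \<otimes>\<^bsub>free_group\<^esub> f"
      using \<phi> unfolding basis_conj_auts_def by blast
    then have "ab (\<phi> (gen i)) = (ab (inv\<^bsub>free_group\<^esub> f) * ab f) * ab (gen i)"
      by (simp add: mult ab_mult algebra_simps)
    then show ?thesis using fox_inv_mult(1)[OF f] by simp
  qed
  have foxg: "fox (\<phi> (gen i)) = axis i 1 v* fox_jacobian \<phi>" for i
    by (auto simp: fox_jacobian_def vector_matrix_mult_def axis_def vec_eq_iff
        if_distrib[where f="\<lambda>c. c * _"]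
        cong: if_cong)
  have letter: "ab (\<phi> [a]) = ab [a] \<and> fox (\<phi> [a]) = fox [a] v* fox_jacobian \<phi>" for a
  proof (cases "snd a")
    case True
    then have "[a] = gen (fst a)" by (cases a) (auto simp: gen_def)
    then show ?thesis using abg[of "fst a"] foxg[of "fst a"] True by (auto simp: gen_def)
  next
    case False
    then have a: "[a] = inv\<^bsub>free_group\<^esub> gen (fst a)" by (cases a) (auto simp: inv_gen)
    have \<phi>a: "\<phi> [a] = inv\<^bsub>free_group\<^esub> \<phi> (gen (fst a))" by (simp add: a)
    have g: "\<phi> (gen (fst a)) \<in> carrier free_group" by simp
    have "ab (\<phi> [a]) * tvar (fst a) = 1"
      using fox_inv_mult(1)[OF g] abg[of "fst a"] by (simp add: \<phi>a) (simp add: ab_def ab_letter_def gen_def)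
    then have "ab (\<phi> [a]) * tvar (fst a) * tvar_inv (fst a) = tvar_inv (fst a)" by simp
    then have ab: "ab (\<phi> [a]) = tvar_inv (fst a)" by (simp add: mult.assoc)
    have "fox (\<phi> [a]) = - (tvar_inv (fst a) *s fox (\<phi> (gen (fst a))))"
      using fox_inv_mult(2)[OF g] ab by (simp add: \<phi>a)
    also have "\<dots> = axis (fst a) (- tvar_inv (fst a)) v* fox_jacobian \<phi>"
      unfolding foxg
      by (auto simp: vector_matrix_mult_def axis_def vec_eq_iff
          if_distrib[where f="\<lambda>c. c * _"] cong: if_cong)
    finally show ?thesis using ab False by (simp add: ab_def ab_letter_def)
  qed
  from w show ?thesis
  proof (induction w)
    case Nil
    have "\<phi> [] = []" using p.hom_one by (simp add: free_group_def)
    then show ?case by (simp add: vector_matrix_mult_def vec_eq_iff)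
  next
    case (Cons a w)
    have "[a] \<in> carrier free_group" and w: "w \<in> carrier free_group"
      and eq: "a # w = [a] \<otimes>\<^bsub>free_group\<^esub> w"
      using Cons.prems by (auto simp: free_group_def push_Cons_reduced dest: reduced_ConsD)
    then have \<phi>aw: "\<phi> (a # w) = foldr push (\<phi> [a]) (\<phi> w)" by (metis p.hom_mult mult)
    have aw: "a # w = foldr push [a] w" using eq by (simp add: mult)
    have "ab (\<phi> (a # w)) = ab (a # w)"
      using letter[of a] Cons.IH[OF w] unfolding \<phi>aw ab_mult by (simp add: ab_def)
    moreover have "fox (\<phi> (a # w)) = (fox [a] + ab [a] *s fox w) v* fox_jacobian \<phi>"
      using letter[of a] Cons.IH[OF w] unfolding \<phi>aw fox_mult
      by (simp add: vector_matrix_mult_def vec_eq_iff algebra_simps sum.distrib sum_distrib_left)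
    then have "fox (\<phi> (a # w)) = fox (a # w) v* fox_jacobian \<phi>"
      by (subst (2) aw) (simp only: fox_mult)
    ultimately show ?case by simp
  qed
qed

lemma is_ext_gassner_rep_fox_jacobian:
  "is_ext_gassner_rep (fox_jacobian :: ('n::finite fword \<Rightarrow> 'n fword) \<Rightarrow> _)"
proof -
  interpret F: group "free_group :: 'n fword monoid" by (rule group_free_group)
  interpret C: group "Cb :: ('n fword \<Rightarrow> 'n fword) monoid" by (rule group_Cb)
  have mult: "fox_jacobian (\<phi> \<otimes>\<^bsub>Cb\<^esub> \<psi>) = fox_jacobian \<phi> ** fox_jacobian \<psi>"
    if "\<phi> \<in> carrier Cb" "\<psi> \<in> carrier Cb" for \<phi> \<psi> :: "'n fword \<Rightarrow> 'n fword"
  proof -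
    have \<phi>: "\<phi> \<in> basis_conj_auts" and \<psi>: "\<psi> \<in> basis_conj_auts"
      using that by (auto simp: Cb_def)
    then have mem: "\<phi> (gen i) \<in> carrier free_group" for i
      by (auto simp: basis_conj_auts_def auto_def hom_def)
    have "(\<phi> \<otimes>\<^bsub>Cb\<^esub> \<psi>) (gen i) = \<psi> (\<phi> (gen i))" for i
      using \<phi> \<psi> by (simp add: Cb_def AutoGroup_def BijGroup_def auto_def basis_conj_auts_def compose_eq)
    then have "fox ((\<phi> \<otimes>\<^bsub>Cb\<^esub> \<psi>) (gen i)) = fox (\<phi> (gen i)) v* fox_jacobian \<psi>" for i
      using basis_conj_fox[OF \<psi> mem] by simp
    then show ?thesis
      by (simp add: fox_jacobian_def[of "\<phi> \<otimes>\<^bsub>Cb\<^esub> \<psi>"] fox_jacobian_def[of \<phi>]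
          matrix_matrix_mult_def vector_matrix_mult_def vec_eq_iff mult.commute)
  qed
  have one: "fox_jacobian \<one>\<^bsub>Cb\<^esub> = (mat 1 :: 'n laurent ^ 'n ^ 'n)"
    by (simp add: fox_jacobian_def Cb_def AutoGroup_def BijGroup_def)
      (auto simp: gen_def vec_eq_iff mat_def axis_def)
  have inv: "invertible (fox_jacobian \<phi>)" if "\<phi> \<in> carrier Cb" for \<phi> :: "'n fword \<Rightarrow> 'n fword"
    unfolding invertible_def using that
    by (intro exI[of _ "fox_jacobian (inv\<^bsub>Cb\<^esub> \<phi>)"]) (simp add: one flip: mult)
  have "fox_jacobian (eps i j) = gassner_mat i j" if ij: "i \<noteq> j" for i j :: 'n
  proof -
    have "fox (eps i j (gen l)) = gassner_mat i j $ l" for l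
      using ij eps_gen[OF ij] unfolding inv_gen
      by (cases "l = i")
        (auto simp: free_group_def gen_def inv_letter_def gassner_mat_def mat_def axis_def
          vec_eq_iff ab_letter_def algebra_simps)
    then show ?thesis by (simp add: fox_jacobian_def vec_eq_iff)
  qed
  then show ?thesis
    using mult inv by (auto simp: is_ext_gassner_rep_def hom_def GL_def)
qed

end

theory Submission
  imports Defs "HOL-Algebra.Generated_Groups"
begin

text \<open>
  On a generator \<open>\<epsilon>\<^sub>i\<^sub>j\<close> only row \<open>i\<close> of the matrix differs from the identity, and
  \<open>t\<^sub>j\<^sup>-\<^sup>1 (t\<^sub>i - 1) + t\<^sub>j\<^sup>-\<^sup>1 (t\<^sub>i - 1) (t\<^sub>j - 1) = t\<^sub>i - 1\<close>. So every generator fixes the column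
  vector \<open>(t\<^sub>1 - 1, \<dots>, t\<^sub>n - 1)\<close>, and the line it spans over the fraction field is a proper nonzero
  invariant subspace as soon as \<open>n \<ge> 2\<close>. (For Fox derivatives this is the fundamental formula
  \<open>w - 1 = \<Sum>\<^sub>i (\<partial>w/\<partial>x\<^sub>i) (x\<^sub>i - 1)\<close> after abelianisation.)

  A representation is prescribed only on the \<open>\<epsilon>\<^sub>i\<^sub>j\<close>, so the argument rests on McCool's
  theorem that these generate the group, \<open>generate_Cb\<close>. It is proved by a length
  reduction in the style of Artin. Write \<open>\<phi>(x\<^sub>i) = f\<^sub>i\<^sup>-\<^sup>1 x\<^sub>i f\<^sub>i\<close> without cancellation. If some
  \<open>f\<^sub>j\<close> ends in \<open>x\<^sub>i\<^sup>\<plusminus>\<^sup>1 f\<^sub>i\<close>, then multiplying \<open>\<phi>\<close> from the left by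
  \<open>\<epsilon>\<^sub>j\<^sub>i\<close> or its inverse deletes the letter \<open>x\<^sub>i\<^sup>\<plusminus>\<^sup>1\<close> from \<open>f\<^sub>j\<close> and
  shortens \<open>\<phi>(x\<^sub>j)\<close> (\<open>shorter_conjugator\<close>). If this never happens, the central letter of
  each factor survives in a product of the \<open>\<phi>(x\<^sub>i)\<^sup>\<plusminus>\<^sup>1\<close>
  (\<open>image_starts_with_conjugator\<close>); since every \<open>x\<^sub>k\<close> is such a product, being in the image of
  \<open>\<phi>\<close>, every \<open>f\<^sub>k\<close> is empty and \<open>\<phi>\<close> is the identity.
\<close>

section \<open>Reduced words\<close>

definition inv_word :: "'n fword \<Rightarrow> 'n fword" where
  "inv_word w = rev (map inv_letter w)"

lemma inv_word_simps [simp]: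
  "inv_word [] = []" "inv_word (a # w) = inv_word w @ [inv_letter a]"
  "inv_word (u @ v) = inv_word v @ inv_word u" "inv_word (inv_word w) = w"
  "length (inv_word w) = length w" "inv_word w = [] \<longleftrightarrow> w = []"
  by (simp_all add: inv_word_def rev_map comp_def)

lemma last_inv_word: "w \<noteq> [] \<Longrightarrow> last (inv_word w) = inv_letter (hd w)"
  by (simp add: inv_word_def last_rev hd_map)

lemma reduced_append_iff:
  "reduced (u @ v) \<longleftrightarrow>
    reduced u \<and> reduced v \<and> (u = [] \<or> v = [] \<or> hd v \<noteq> inv_letter (last u))"
  by (auto simp: reduced_def successively_append_iff)

lemma reduced_inv_word_iff [simp]: "reduced (inv_word w) \<longleftrightarrow> reduced w"
  using reduced_inv_word[of w] reduced_inv_word[of "inv_word w"]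
  by (metis inv_word_def inv_word_simps(4))

lemma foldr_push_reduced_append: "reduced (u @ v) \<Longrightarrow> foldr push u v = u @ v"
proof (induction u)
  case (Cons a u)
  then show ?case using push_Cons_reduced[of a "u @ v"] reduced_ConsD[of a "u @ v"] by simp
qed simp

lemma length_foldr_push: "length (foldr push u v) \<le> length u + length v"
proof (induction u)
  case (Cons a u)
  have "length (push a w) \<le> Suc (length w)" for w :: "'a fword"
    by (cases w) auto
  from this[of "foldr push u v"] Cons show ?case by simp
qed simp

lemma free_group_simps:
  "carrier free_group = {w. reduced w}" "u \<otimes>\<^bsub>free_group\<^esub> v = foldr push u v"
  "\<one>\<^bsub>free_group\<^esub> = []"
  by (simp_all add: free_group_def)

lemma inv_free_group:
  assumes "reduced w" shows "inv\<^bsub>free_group\<^esub> w = inv_word w"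
proof -
  interpret F: group "free_group :: 'a fword monoid" by (rule group_free_group)
  show ?thesis
    using assms foldr_push_inv_word[of w]
    by (intro F.inv_equality) (auto simp: free_group_simps simp flip: inv_word_def)
qed


section \<open>Words conjugating a generator without cancellation\<close>

text \<open>
  The condition on the first letter is what makes \<open>f\<^sup>-\<^sup>1 x\<^sub>i f\<close> reduced as it stands: a leading power
  of \<open>x\<^sub>i\<close> in \<open>f\<close> would commute with \<open>x\<^sub>i\<close> and cancel.
\<close>

definition conjugator :: "'n \<Rightarrow> 'n fword \<Rightarrow> bool" where
  "conjugator i f \<longleftrightarrow> reduced f \<and> (f = [] \<or> fst (hd f) \<noteq> i)"

lemma reduced_conjugator:
  assumes "conjugator i f" "reduced ((i, e) # z)"
  shows "reduced (inv_word f @ (i, e) # z)"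
  using assms by (cases "f = []") (auto simp: conjugator_def reduced_append_iff last_inv_word prod_eq_iff)

lemma reduced_conjugate:
  assumes "conjugator i f" shows "reduced (inv_word f @ (i, e) # f)"
proof (rule reduced_conjugator[OF assms])
  show "reduced ((i, e) # f)"
    using assms by (cases f) (auto simp: conjugator_def inv_letter_def)
qed

lemma conjugate_eq_append:
  assumes "conjugator i f"
  shows "inv\<^bsub>free_group\<^esub> f \<otimes>\<^bsub>free_group\<^esub> [(i, e)] \<otimes>\<^bsub>free_group\<^esub> f = inv_word f @ (i, e) # f"
proof -
  have f: "reduced f" using assms by (simp add: conjugator_def)
  have r: "reduced (inv_word f @ (i, e) # f)" by (rule reduced_conjugate[OF assms])
  then have "reduced (inv_word f @ [(i, e)])"
    by (auto simp: reduced_append_iff)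
  then show ?thesis
    using r f by (simp add: free_group_simps(2) inv_free_group foldr_push_reduced_append
      del: foldr_append)
qed

text \<open>Leading letters \<open>x\<^sub>i\<^sup>\<plusminus>\<^sup>1\<close> of \<open>f\<close> can be stripped off, as they commute with \<open>x\<^sub>i\<close>.\<close>

lemma obtain_conjugator:
  assumes "reduced f"
  obtains h where "conjugator i h"
    "inv\<^bsub>free_group\<^esub> f \<otimes>\<^bsub>free_group\<^esub> gen i \<otimes>\<^bsub>free_group\<^esub> f = inv_word h @ (i, True) # h"
  using assms
proof (induction f arbitrary: thesis)
  case Nil
  have "conjugator i []" by (simp add: conjugator_def)
  from Nil(1)[OF this] conjugate_eq_append[OF this, of True] show ?case by (simp add: gen_def)
next
  case (Cons a f)
  interpret F: group "free_group :: 'a fword monoid" by (rule group_free_group)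
  have f: "reduced f" using Cons.prems(2) by (rule reduced_ConsD)
  show ?case
  proof (cases "fst a = i")
    case False
    then have "conjugator i (a # f)" using Cons.prems(2) by (simp add: conjugator_def)
    from Cons.prems(1)[OF this] conjugate_eq_append[OF this, of True] show ?thesis
      by (simp add: gen_def)
  next
    case True
    have af: "a # f = [a] \<otimes>\<^bsub>free_group\<^esub> f"
      using Cons.prems(2) by (simp add: free_group_simps push_Cons_reduced)
    have car: "[a] \<in> carrier free_group" "f \<in> carrier free_group"
      using f by (auto simp: free_group_simps)
    have "inv\<^bsub>free_group\<^esub> [a] \<otimes>\<^bsub>free_group\<^esub> (gen i \<otimes>\<^bsub>free_group\<^esub> [a]) = gen i"
      using True
      by (cases a) (auto simp: inv_free_group free_group_simps gen_def inv_letter_def)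
    then have "inv\<^bsub>free_group\<^esub> (a # f) \<otimes>\<^bsub>free_group\<^esub> gen i \<otimes>\<^bsub>free_group\<^esub> (a # f)
        = inv\<^bsub>free_group\<^esub> f \<otimes>\<^bsub>free_group\<^esub> gen i \<otimes>\<^bsub>free_group\<^esub> f"
      unfolding af using car by (simp add: F.inv_mult_group F.m_assoc)
        (metis F.inv_closed F.m_assoc F.m_closed gen_in)
    then show ?thesis using Cons.IH[OF Cons.prems(1) f] by simp
  qed
qed

lemma append_Cons_eq_append_ConsD:
  assumes "u @ a # v = u' @ a' # v'"
  shows "a = a' \<or> (\<exists>p. u' = u @ a # p) \<or> (\<exists>p. u = u' @ a' # p)"
  using assms
proof (induction u arbitrary: u')
  case Nil
  then show ?case by (cases u') auto
next
  case (Cons b u)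
  then show ?case by (cases u') auto
qed

text \<open>
  Suppose the cancellation between \<open>\<phi>(x\<^sub>i\<^sup>e)\<close> and \<open>\<phi>(u)\<close> reached the central letter
  \<open>x\<^sub>i\<^sup>e\<close>, where \<open>u\<close> begins with \<open>x\<^sub>j\<^sup>d\<close>. Then the reduced word \<open>\<phi>(u)\<close> would begin both with
  \<open>f\<^sub>i\<^sup>-\<^sup>1 x\<^sub>i\<^sup>-\<^sup>e\<close> and, by induction, with \<open>f\<^sub>j\<^sup>-\<^sup>1 x\<^sub>j\<^sup>d\<close>. If these prefixes differ in length, then
  one of the conjugators ends in the other preceded by a central letter, against \<open>nosuffix\<close>; if they have the
  same length, then \<open>x\<^sub>j\<^sup>d = x\<^sub>i\<^sup>-\<^sup>e\<close> and \<open>x\<^sub>i\<^sup>e u\<close> is not reduced.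
\<close>

lemma image_starts_with_conjugator:
  assumes \<phi>: "\<phi> \<in> hom free_group free_group"
    and f: "\<And>i. conjugator i (f i)"
    and \<phi>f: "\<And>i e. \<phi> [(i, e)] = inv_word (f i) @ (i, e) # f i"
    and nosuffix: "\<And>i j e g. f j \<noteq> g @ (i, e) # f i"
    and u: "reduced ((i, e) # u)"
  shows "\<exists>s. \<phi> ((i, e) # u) = inv_word (f i) @ (i, e) # s"
  using u
proof (induction u arbitrary: i e)
  case Nil
  then show ?case using \<phi>f by simp
next
  case (Cons b u)
  obtain j d where b: "b = (j, d)" by (cases b)
  have bred: "reduced ((j, d) # u)" and ne: "(j, d) \<noteq> (i, \<not> e)"
    using Cons.prems by (auto simp: b inv_letter_def)
  obtain s where s: "\<phi> ((j, d) # u) = inv_word (f j) @ (j, d) # s"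
    using Cons.IH[OF bred] by blast
  define y where "y = \<phi> ((j, d) # u)"
  have y: "reduced y"
    using \<phi> bred by (auto simp: y_def hom_def free_group_simps)
  \<comment> \<open>The part of \<open>\<phi>(x\<^sub>i\<^sup>e x\<^sub>j\<^sup>d u)\<close> to the right of the central letter \<open>x\<^sub>i\<^sup>e\<close>; it remains to see that
    it does not begin with \<open>x\<^sub>i\<^sup>-\<^sup>e\<close>.\<close>
  define z where "z = foldr push (f i) y"
  have z: "reduced z" unfolding z_def by (rule reduced_foldr_push[OF y])
  have yz: "foldr push (inv_word (f i)) z = y"
    using foldr_push_assoc[OF y, of "inv_word (f i)" "f i"] foldr_push_inv_word[of "f i"]
    by (simp add: z_def inv_word_def)
  have "reduced ((i, e) # z)"
  proof (rule ccontr)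
    assume "\<not> ?thesis"
    then obtain z' where z': "z = (i, \<not> e) # z'"
      using z by (cases z) (auto simp: inv_letter_def)
    then have "reduced (inv_word (f i) @ (i, \<not> e) # z')"
      using reduced_conjugator[OF f] z by blast
    \<comment> \<open>Both sides are reduced words for \<open>\<phi>(x\<^sub>j\<^sup>d u)\<close>.\<close>
    then have "inv_word (f i) @ (i, \<not> e) # z' = inv_word (f j) @ (j, d) # s"
      using yz s foldr_push_reduced_append by (metis y_def z')
    then consider "(i, \<not> e) = (j, d)"
      | p where "inv_word (f j) = inv_word (f i) @ (i, \<not> e) # p"
      | p where "inv_word (f i) = inv_word (f j) @ (j, d) # p"
      by (blast dest: append_Cons_eq_append_ConsD)
    then show False
    proof cases
      case 1
      then show ?thesis using ne by simp
    next
      case 2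
      then have "f j = inv_word p @ (i, e) # f i"
        by (metis inv_word_simps(2-4) append_assoc append_Cons append_Nil inv_letter_def
            fst_conv snd_conv)
      then show ?thesis using nosuffix by blast
    next
      case 3
      then have "f i = inv_word p @ (j, \<not> d) # f j"
        by (metis inv_word_simps(2-4) append_assoc append_Cons append_Nil inv_letter_def
            fst_conv snd_conv)
      then show ?thesis using nosuffix by blast
    qed
  qed
  then have red: "reduced (inv_word (f i) @ (i, e) # z)" by (rule reduced_conjugator[OF f])
  have "(i, e) # b # u = [(i, e)] \<otimes>\<^bsub>free_group\<^esub> ((j, d) # u)"
    using Cons.prems by (simp add: free_group_simps b)
  then have "\<phi> ((i, e) # b # u) = foldr push (\<phi> [(i, e)]) y"
    using \<phi> bred by (simp only: hom_def free_group_simps(1) y_def) (simp add: free_group_simps(2) del: foldr.simps)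
  also have "\<dots> = foldr push (inv_word (f i) @ [(i, e)]) z"
    by (simp add: \<phi>f z_def)
  also have "\<dots> = inv_word (f i) @ (i, e) # z"
    using foldr_push_reduced_append[of "inv_word (f i) @ [(i, e)]" z] red by simp
  finally show ?case by blast
qed


section \<open>Generation by the elementary conjugations\<close>

lemma Cb_simps:
  "carrier Cb = basis_conj_auts"
  "\<phi> \<in> carrier Cb \<Longrightarrow> \<psi> \<in> carrier Cb \<Longrightarrow> w \<in> carrier free_group \<Longrightarrow> (\<phi> \<otimes>\<^bsub>Cb\<^esub> \<psi>) w = \<psi> (\<phi> w)"
  "w \<in> carrier free_group \<Longrightarrow> \<one>\<^bsub>Cb\<^esub> w = w"
  by (auto simp: Cb_def AutoGroup_def BijGroup_def auto_def basis_conj_auts_def compose_eq)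

lemma Cb_hom: "\<phi> \<in> carrier Cb \<Longrightarrow> group_hom free_group free_group \<phi>"
  by (auto simp: Cb_simps(1) basis_conj_auts_def auto_def group_hom_def group_hom_axioms_def
      group_free_group)

lemma Cb_eqI:
  assumes \<phi>: "\<phi> \<in> carrier Cb" and \<psi>: "\<psi> \<in> carrier Cb" and eq: "\<And>i. \<phi> (gen i) = \<psi> (gen i)"
  shows "\<phi> = \<psi>"
proof
  fix w
  have hom: "\<phi> \<in> hom free_group free_group" "\<psi> \<in> hom free_group free_group"
    using \<phi> \<psi> by (auto simp: Cb_simps(1) basis_conj_auts_def auto_def)
  have ext: "\<phi> \<in> extensional (carrier free_group)" "\<psi> \<in> extensional (carrier free_group)"
    using \<phi> \<psi> by (auto simp: Cb_simps(1) basis_conj_auts_def auto_def Bij_def)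
  show "\<phi> w = \<psi> w"
  proof (cases "w \<in> carrier free_group")
    case True
    then show ?thesis using free_group_hom_eqI[OF group_free_group hom] eq by blast
  next
    case False
    then show ?thesis using ext by (simp add: extensional_def)
  qed
qed

lemma Cb_conjugators:
  assumes \<phi>: "\<phi> \<in> carrier Cb"
  obtains f where "\<And>i. conjugator i (f i)" "\<And>i e. \<phi> [(i, e)] = inv_word (f i) @ (i, e) # f i"
proof -
  interpret p: group_hom free_group free_group \<phi> by (rule Cb_hom[OF \<phi>])
  have "\<exists>h. conjugator i h \<and> \<phi> (gen i) = inv_word h @ (i, True) # h" for i
  proof -
    obtain g where "reduced g"
      "\<phi> (gen i) = inv\<^bsub>free_group\<^esub> g \<otimes>\<^bsub>free_group\<^esub> gen i \<otimes>\<^bsub>free_group\<^esub> g"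
      using \<phi> by (auto simp: Cb_simps(1) basis_conj_auts_def free_group_simps(1))
    then show ?thesis using obtain_conjugator[of g i] by metis
  qed
  then obtain f where f: "\<And>i. conjugator i (f i)"
    and t: "\<And>i. \<phi> (gen i) = inv_word (f i) @ (i, True) # f i" by metis
  have "\<phi> [(i, False)] = inv_word (f i) @ (i, False) # f i" for i
  proof -
    have "\<phi> [(i, False)] = inv\<^bsub>free_group\<^esub> \<phi> (gen i)"
      by (simp add: inv_gen flip: p.hom_inv)
    also have "\<dots> = inv_word (f i) @ (i, False) # f i"
      using reduced_conjugate[OF f, of i True] by (simp add: t inv_free_group inv_letter_def)
    finally show ?thesis .
  qed
  then have "\<phi> [(i, e)] = inv_word (f i) @ (i, e) # f i" for i e
    using t by (cases e) (auto simp: gen_def)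
  with f that show thesis by blast
qed

text \<open>
  The sign \<open>e\<close> selects the generator or its inverse, so that the length reduction can
  treat both signs of the letter \<open>x\<^sub>i\<^sup>e\<close> alike.
\<close>

lemma elementary_conjugation:
  assumes ij: "i \<noteq> j"
  obtains \<psi> where "\<psi> = eps j i \<or> \<psi> = inv\<^bsub>Cb\<^esub> eps j i"
    "\<And>l. \<psi> (gen l) = (if l = j
      then [(i, e)] \<otimes>\<^bsub>free_group\<^esub> gen j \<otimes>\<^bsub>free_group\<^esub> inv\<^bsub>free_group\<^esub> [(i, e)] else gen l)"
proof -
  interpret F: group "free_group :: 'a fword monoid" by (rule group_free_group)
  interpret C: group "Cb :: ('a fword \<Rightarrow> 'a fword) monoid" by (rule group_Cb)
  have E: "eps j i \<in> carrier Cb" using eps_in_Cb[of j i] ij by auto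
  show thesis
  proof (cases e)
    case False
    have "eps j i (gen l) = (if l = j
      then [(i, e)] \<otimes>\<^bsub>free_group\<^esub> gen j \<otimes>\<^bsub>free_group\<^esub> inv\<^bsub>free_group\<^esub> [(i, e)] else gen l)" for l
      using eps_gen[of j i] ij False by (simp flip: inv_gen)
    then show thesis using that by blast
  next
    case True
    define \<psi> where "\<psi> = inv\<^bsub>Cb\<^esub> eps j i"
    have \<psi>: "\<psi> \<in> carrier Cb" using E by (simp add: \<psi>_def)
    interpret p: group_hom free_group free_group \<psi> by (rule Cb_hom[OF \<psi>])
    have inv: "\<psi> (eps j i w) = w" if "w \<in> carrier free_group" for w
      using Cb_simps(2)[OF E \<psi> that] C.r_inv[OF E] Cb_simps(3)[OF that] by (simp add: \<psi>_def)
    have other: "\<psi> (gen l) = gen l" if "l \<noteq> j" for l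
      using inv[of "gen l"] eps_gen[of j i] ij that by simp
    have "gen j = inv\<^bsub>free_group\<^esub> gen i \<otimes>\<^bsub>free_group\<^esub> \<psi> (gen j) \<otimes>\<^bsub>free_group\<^esub> gen i"
      using inv[of "gen j"] eps_gen[of j i] ij other[of i] by simp
    then have "\<psi> (gen j) = gen i \<otimes>\<^bsub>free_group\<^esub> gen j \<otimes>\<^bsub>free_group\<^esub> inv\<^bsub>free_group\<^esub> gen i"
      by (metis F.inv_closed F.inv_solve_left F.inv_solve_right' F.m_closed F.m_assoc gen_in p.hom_closed)
    then show thesis using that[of \<psi>] other True by (auto simp: \<psi>_def gen_def)
  qed
qed

text \<open>
  If \<open>f\<^sub>j = g x\<^sub>i\<^sup>e f\<^sub>i\<close>, then \<open>f\<^sub>j \<phi>(x\<^sub>i)\<^sup>-\<^sup>e = g f\<^sub>i\<close>, so \<open>\<phi>(x\<^sub>i\<^sup>e x\<^sub>j x\<^sub>i\<^sup>-\<^sup>e)\<close> is \<open>x\<^sub>j\<close> conjugated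
  by \<open>g f\<^sub>i\<close>, a shorter word than \<open>f\<^sub>j\<close>.
\<close>

lemma shorter_conjugator:
  assumes \<phi>: "\<phi> \<in> carrier Cb"
    and f: "\<And>i. conjugator i (f i)" and \<phi>f: "\<And>i e. \<phi> [(i, e)] = inv_word (f i) @ (i, e) # f i"
    and ij: "i \<noteq> j" and fj: "f j = g @ (i, e) # f i"
  shows "length (\<phi> ([(i, e)] \<otimes>\<^bsub>free_group\<^esub> gen j \<otimes>\<^bsub>free_group\<^esub> inv\<^bsub>free_group\<^esub> [(i, e)]))
    < length (\<phi> (gen j))"
proof -
  interpret F: group "free_group :: 'a fword monoid" by (rule group_free_group)
  interpret p: group_hom free_group free_group \<phi> by (rule Cb_hom[OF \<phi>])
  define h where "h = g \<otimes>\<^bsub>free_group\<^esub> f i"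
  have cancel: "inv\<^bsub>free_group\<^esub> a \<otimes>\<^bsub>free_group\<^esub> (a \<otimes>\<^bsub>free_group\<^esub> b) = b"
    "a \<otimes>\<^bsub>free_group\<^esub> (inv\<^bsub>free_group\<^esub> a \<otimes>\<^bsub>free_group\<^esub> b) = b"
    if "a \<in> carrier free_group" "b \<in> carrier free_group" for a b :: "'a fword"
    using that by (simp_all flip: F.m_assoc)
  have redj: "reduced (g @ (i, e) # f i)" using f[of j] fj by (simp add: conjugator_def)
  have red: "reduced ((i, e) # f i)" "reduced g" "reduced (f i)"
    using redj by (auto simp: reduced_append_iff dest: reduced_ConsD)
  have car [simp]: "g \<in> carrier free_group" "f i \<in> carrier free_group" "[(i, e)] \<in> carrier free_group"
    using red by (auto simp: free_group_simps)
  have fj': "f j = g \<otimes>\<^bsub>free_group\<^esub> ([(i, e)] \<otimes>\<^bsub>free_group\<^esub> f i)"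
    using redj red by (simp add: fj free_group_simps foldr_push_reduced_append push_Cons_reduced)
  have conj: "\<phi> [(l, d)] = inv\<^bsub>free_group\<^esub> f l \<otimes>\<^bsub>free_group\<^esub> [(l, d)] \<otimes>\<^bsub>free_group\<^esub> f l" for l d
    using conjugate_eq_append[OF f] \<phi>f by metis
  have "\<phi> ([(i, e)] \<otimes>\<^bsub>free_group\<^esub> gen j \<otimes>\<^bsub>free_group\<^esub> inv\<^bsub>free_group\<^esub> [(i, e)])
      = inv\<^bsub>free_group\<^esub> h \<otimes>\<^bsub>free_group\<^esub> gen j \<otimes>\<^bsub>free_group\<^esub> h"
    using conj[of i e] conj[of j True]
    by (simp add: fj' h_def F.inv_mult_group F.m_assoc cancel flip: gen_def)
  also have "length \<dots> \<le> length (inv\<^bsub>free_group\<^esub> h) + 1 + length h"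
    using length_foldr_push[of "foldr push (inv\<^bsub>free_group\<^esub> h) (gen j)" h]
      length_foldr_push[of "inv\<^bsub>free_group\<^esub> h" "gen j"]
    by (simp add: free_group_simps gen_def del: foldr_append)
  also have "\<dots> = 2 * length h + 1"
  proof -
    have "reduced h" using F.m_closed[OF car(1,2)] by (simp only: h_def free_group_simps(1) mem_Collect_eq)
    then show ?thesis by (simp add: inv_free_group)
  qed
  also have "\<dots> < length (\<phi> (gen j))"
    using length_foldr_push[of g "f i"] by (simp add: h_def free_group_simps(2) gen_def \<phi>f fj)
  finally show ?thesis .
qed

text \<open>McCool's theorem, by induction on the total length of the images of the generators.\<close>

theorem generate_Cb:
  "carrier (Cb :: ('n::finite fword \<Rightarrow> 'n fword) monoid) = generate Cb {eps i j | i j. i \<noteq> j}"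
proof
  interpret C: group "Cb :: ('n fword \<Rightarrow> 'n fword) monoid" by (rule group_Cb)
  let ?E = "{eps i j | i j. i \<noteq> j} :: ('n fword \<Rightarrow> 'n fword) set"
  have E: "?E \<subseteq> carrier Cb" using eps_in_Cb by auto
  then show "generate Cb ?E \<subseteq> carrier Cb" by (rule C.generate_incl)
  have "\<phi> \<in> generate Cb ?E" if "\<phi> \<in> carrier Cb" for \<phi>
    using that
  proof (induction "\<Sum>i\<in>UNIV. length (\<phi> (gen i))" arbitrary: \<phi> rule: less_induct)
    case less
    obtain f where f: "\<And>i. conjugator i (f i)"
      and \<phi>f: "\<And>i e. \<phi> [(i, e)] = inv_word (f i) @ (i, e) # f i"
      by (rule Cb_conjugators[OF less.prems]) blast
    interpret p: group_hom free_group free_group \<phi> by (rule Cb_hom[OF less.prems])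
    show ?case
    proof (cases "\<exists>i j e g. f j = g @ (i, e) # f i")
      case True
      then obtain i j e g where fj: "f j = g @ (i, e) # f i" by blast
      have ij: "i \<noteq> j"
      proof
        assume "i = j"
        then show False using arg_cong[OF fj, of length] by simp
      qed
      obtain \<psi> where \<psi>: "\<psi> = eps j i \<or> \<psi> = inv\<^bsub>Cb\<^esub> eps j i"
        and \<psi>g: "\<And>l. \<psi> (gen l) = (if l = j
          then [(i, e)] \<otimes>\<^bsub>free_group\<^esub> gen j \<otimes>\<^bsub>free_group\<^esub> inv\<^bsub>free_group\<^esub> [(i, e)] else gen l)"
        by (rule elementary_conjugation[OF ij, of e]) blast
      have "eps j i \<in> ?E" using ij by blast
      then have \<psi>gen: "\<psi> \<in> generate Cb ?E" using \<psi> by (auto intro: generate.intros)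
      then have \<psi>C: "\<psi> \<in> carrier Cb" using C.generate_incl[OF E] by blast
      have app: "(\<psi> \<otimes>\<^bsub>Cb\<^esub> \<phi>) (gen l) = \<phi> (\<psi> (gen l))" for l
        by (rule Cb_simps(2)[OF \<psi>C less.prems gen_in])
      have "(\<Sum>l\<in>UNIV. length ((\<psi> \<otimes>\<^bsub>Cb\<^esub> \<phi>) (gen l))) < (\<Sum>l\<in>UNIV. length (\<phi> (gen l)))"
      proof (rule sum_strict_mono_ex1)
        have short: "length (\<phi> (\<psi> (gen j))) < length (\<phi> (gen j))"
          using shorter_conjugator[OF less.prems f \<phi>f ij fj] by (simp add: \<psi>g)
        then show "\<exists>l\<in>UNIV. length ((\<psi> \<otimes>\<^bsub>Cb\<^esub> \<phi>) (gen l)) < length (\<phi> (gen l))"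
          unfolding app by blast
        have "length (\<phi> (\<psi> (gen l))) \<le> length (\<phi> (gen l))" for l
          using short by (cases "l = j") (simp_all add: \<psi>g)
        then show "\<forall>l\<in>UNIV. length ((\<psi> \<otimes>\<^bsub>Cb\<^esub> \<phi>) (gen l)) \<le> length (\<phi> (gen l))"
          unfolding app by blast
      qed simp
      then have "\<psi> \<otimes>\<^bsub>Cb\<^esub> \<phi> \<in> generate Cb ?E"
        by (rule less.hyps) (simp add: \<psi>C less.prems)
      then have "inv\<^bsub>Cb\<^esub> \<psi> \<otimes>\<^bsub>Cb\<^esub> (\<psi> \<otimes>\<^bsub>Cb\<^esub> \<phi>) \<in> generate Cb ?E"
        by (rule generate.eng[OF C.generate_m_inv_closed[OF E \<psi>gen]])
      moreover have "inv\<^bsub>Cb\<^esub> \<psi> \<otimes>\<^bsub>Cb\<^esub> (\<psi> \<otimes>\<^bsub>Cb\<^esub> \<phi>) = \<phi>"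
        using \<psi>C less.prems by (simp flip: C.m_assoc)
      ultimately show ?thesis by simp
    next
      case False
      have fk: "f k = []" for k
      proof -
        have "\<phi> ` carrier free_group = carrier free_group"
          using less.prems
          by (auto simp: Cb_simps(1) basis_conj_auts_def auto_def Bij_def bij_betw_def)
        then obtain u where u: "u \<in> carrier free_group" "\<phi> u = gen k"
          by (metis gen_in imageE)
        have "u \<noteq> []"
        proof
          assume "u = []"
          then show False using u p.hom_one by (simp add: free_group_simps gen_def)
        qed
        then obtain i e u' where u': "u = (i, e) # u'" by (cases u) auto
        have "reduced ((i, e) # u')" using u(1) by (simp add: u' free_group_simps(1))
        moreover have "f j \<noteq> g @ (i, e) # f i" for i j e g using False by blast
        ultimately obtain s where "gen k = inv_word (f i) @ (i, e) # s"
          using image_starts_with_conjugator[OF p.homh f \<phi>f, of i e u'] u(2) unfolding u'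
          by metis
        then show ?thesis by (cases "inv_word (f i)") (auto simp: gen_def)
      qed
      have "\<phi> = \<one>\<^bsub>Cb\<^esub>"
        by (rule Cb_eqI[OF less.prems C.one_closed])
          (simp add: gen_def \<phi>f fk Cb_simps(3) free_group_simps(1))
      then show ?thesis by (simp add: generate.one)
    qed
  qed
  then show "carrier Cb \<subseteq> generate Cb ?E" by blast
qed


section \<open>The invariant line\<close>

text \<open>The entries \<open>t\<^sub>i - 1\<close> generate the augmentation ideal of the Laurent polynomial ring.\<close>

definition augmentation_vector :: "'n::finite laurent ^ 'n" where
  "augmentation_vector = (\<chi> i. tvar i - 1)"

lemma gassner_mat_augmentation_vector:
  assumes "i \<noteq> j"
  shows "gassner_mat i j *v augmentation_vector = augmentation_vector"
proof -
  have "(\<Sum>l\<in>UNIV. gassner_mat i j $ k $ l * (tvar l - 1)) = tvar k - 1" for k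
  proof (cases "k = i")
    case True
    have "(\<Sum>l\<in>UNIV. gassner_mat i j $ k $ l * (tvar l - 1))
      = (\<Sum>l\<in>{i, j}. gassner_mat i j $ k $ l * (tvar l - 1))"
      by (rule sum.mono_neutral_right) (auto simp: gassner_mat_def True)
    also have "\<dots> = tvar_inv j * (tvar i - 1) + tvar_inv j * (tvar i - 1) * (tvar j - 1)"
      using assms by (simp add: gassner_mat_def True)
    also have "\<dots> = tvar_inv j * tvar j * (tvar i - 1)"
      by (simp only: algebra_simps mult_1_left mult_1_right)
    finally show ?thesis by (simp add: True)
  next
    case False
    have "(\<Sum>l\<in>UNIV. gassner_mat i j $ k $ l * (tvar l - 1))
      = (\<Sum>l\<in>{k}. gassner_mat i j $ k $ l * (tvar l - 1))"
      by (rule sum.mono_neutral_right) (auto simp: gassner_mat_def mat_def False)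
    then show ?thesis using False by (simp add: gassner_mat_def mat_def)
  qed
  then show ?thesis
    by (simp add: matrix_vector_mult_def augmentation_vector_def vec_eq_iff)
qed

text \<open>The stabiliser of a vector is a subgroup, so it is enough to know that it contains the generators.\<close>

lemma ext_gassner_rep_augmentation_vector:
  fixes \<rho> :: "('n::finite fword \<Rightarrow> 'n fword) \<Rightarrow> 'n laurent ^ 'n ^ 'n"
  assumes \<rho>: "is_ext_gassner_rep \<rho>" and g: "g \<in> carrier Cb"
  shows "\<rho> g *v augmentation_vector = augmentation_vector"
proof -
  interpret C: group "Cb :: ('n fword \<Rightarrow> 'n fword) monoid" by (rule group_Cb)
  have mult: "\<rho> (a \<otimes>\<^bsub>Cb\<^esub> b) = \<rho> a ** \<rho> b" if "a \<in> carrier Cb" "b \<in> carrier Cb" for a b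
    using \<rho> that by (auto simp: is_ext_gassner_rep_def hom_def GL_def)
  have one: "\<rho> \<one>\<^bsub>Cb\<^esub> = mat 1"
  proof -
    have "invertible (\<rho> \<one>\<^bsub>Cb\<^esub>)"
      using \<rho> by (auto simp: is_ext_gassner_rep_def hom_def GL_def)
    then obtain B where "B ** \<rho> \<one>\<^bsub>Cb\<^esub> = mat 1" by (auto simp: invertible_def)
    moreover have "\<rho> \<one>\<^bsub>Cb\<^esub> ** \<rho> \<one>\<^bsub>Cb\<^esub> = \<rho> \<one>\<^bsub>Cb\<^esub>" by (simp flip: mult)
    ultimately show ?thesis by (metis matrix_mul_assoc matrix_mul_lid)
  qed
  have E: "{eps i j | i j. i \<noteq> j} \<subseteq> carrier (Cb :: ('n fword \<Rightarrow> 'n fword) monoid)"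
    using eps_in_Cb by auto
  have "g \<in> generate Cb {eps i j | i j. i \<noteq> j}" using g generate_Cb by blast
  then show ?thesis
  proof (induction g rule: generate.induct)
    case one
    show ?case by (simp add: \<open>\<rho> \<one>\<^bsub>Cb\<^esub> = mat 1\<close>)
  next
    case (incl h)
    then show ?case
      using \<rho> gassner_mat_augmentation_vector by (auto simp: is_ext_gassner_rep_def)
  next
    case (inv h)
    then have h: "h \<in> carrier Cb" using E by blast
    have "\<rho> (inv\<^bsub>Cb\<^esub> h) *v (\<rho> h *v augmentation_vector) = augmentation_vector"
      using h by (simp add: matrix_vector_mul_assoc one flip: mult)
    moreover have "\<rho> h *v augmentation_vector = augmentation_vector"
      using inv \<rho> gassner_mat_augmentation_vector by (auto simp: is_ext_gassner_rep_def)
    ultimately show ?case by simp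
  next
    case (eng h1 h2)
    then show ?case
      using C.generate_incl[OF E] mult by (simp add: subset_iff flip: matrix_vector_mul_assoc)
  qed
qed

lemma tvar_neq_1: "tvar i \<noteq> 1"
proof
  assume "tvar i = 1"
  then have "Poly_Mapping.lookup (tvar i) 0 = Poly_Mapping.lookup (1 :: 'a laurent) 0" by simp
  then show False by (simp add: tvar_def lookup_single lookup_one when_def)
qed

lemma map_matrix_to_fract_mult:
  "map_matrix to_fract A *v (\<chi> i. to_fract (v $ i)) = (\<chi> i. to_fract ((A *v v) $ i))"
  by (simp add: matrix_vector_mult_def map_matrix_def vec_eq_iff to_fract_sum)

theorem theorem3:
  fixes \<rho> :: "('n::{finite,linorder} fword \<Rightarrow> 'n fword) \<Rightarrow> 'n laurent ^ 'n::_ ^ 'n::_"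
  assumes "CARD('n) \<ge> 2"
    and "is_ext_gassner_rep \<rho>"
  shows "reducible_rep Cb \<rho>"
proof -
  define v :: "'n laurent fract ^ 'n::_"
    where "v = (\<chi> i. to_fract (augmentation_vector $ i))"
  have "v \<noteq> 0"
    by (simp add: v_def vec_eq_iff augmentation_vector_def tvar_neq_1
        del: to_fract_diff)
  have fixed: "map_matrix to_fract (\<rho> g) *v v = v" if "g \<in> carrier Cb"
    for g :: "'n fword \<Rightarrow> 'n fword"
    using ext_gassner_rep_augmentation_vector[OF assms(2) that]
    by (simp add: v_def map_matrix_to_fract_mult)
  show ?thesis
    unfolding reducible_rep_def
  proof (intro exI[of _ "vec.span {v}"] conjI ballI)
    show "vec.subspace (vec.span {v})" by (rule vec.subspace_span)
    show "vec.span {v} \<noteq> {0}" using vec.span_base[of v "{v}"] \<open>v \<noteq> 0\<close> by auto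
    have "vec.dim (vec.span {v}) \<le> 1"
      using vec.dim_le_card[of "{v}" "{v}"] by (simp add: vec.span_superset)
    then show "vec.span {v} \<noteq> UNIV"
      using assms(1) vec_dim_card[where 'a = "'n laurent fract" and 'n = 'n] by force
  next
    fix g :: "'n fword \<Rightarrow> 'n fword" and w
    assume g: "g \<in> carrier Cb" and "w \<in> vec.span {v}"
    then obtain c where w: "w = c *s v" by (auto simp: vec.span_singleton)
    have "map_matrix to_fract (\<rho> g) *v w = w"
      using fixed[OF g] by (simp add: w vector_scalar_commute)
    with \<open>w \<in> vec.span {v}\<close> show "map_matrix to_fract (\<rho> g) *v w \<in> vec.span {v}" by simp
  qed
qed

end
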